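(* Suppose that for every follower $i\in\{1,\dots,n\}$ the maps $y_i\mapsto\theta_i(x,y_i,y_{-i})$ and $y_i\mapsto g_{i,j}(x,y_i)$ ($j=1,\dots,p_i$) are convex, with Slater's constraint qualification satisfied at $x=\bar x$. Suppose that $(\bar x,\bar y)\in\mathbb{R}^{n_0}\times\prod_{i=1}^n\mathbb{R}^{n_i}$ and that for any $\bar\mu\in\Lambda(\bar x,\bar y)$ the vector $(\bar x,\bar y,\bar\mu)$ is a local solution of the MPCC reformulation (MPCC). Then $(\bar x,\bar y)$ is a local solution of the single-leader multi-follower game (SLMFG).
   Context: Setting. There is one leader with decision variable $x\in\mathbb{R}^{n_0}$, restricted to a set $X\subset\mathbb{R}^{n_0}$, and with objective $\theta_0:\mathbb{R}^{n_0}\times\prod_{i=1}^n\mathbb{R}^{n_i}\to\mathbb{R}$. There are $n$ followers; follower $i$ has decision variable $y_i\in\mathbb{R}^{n_i}$. Write $y=(y_1,\dots,y_n)=(y_i,y_{-i})$, where $y_{-i}$ collects the decisions of the followers other than $i$. Follower $i$ has objective $\theta_i(x,y_i,y_{-i})\in\mathbb{R}$ and constraint functions $g_{i,j}:\mathbb{R}^{n_0}\times\mathbb{R}^{n_i}\to\mathbb{R}$, $j=1,\dots,p_i$, with feasible set $Y_i(x)=\{y_i : g_{i,j}(x,y_i)\le 0\ \forall j\}$. Write $g_i=(g_{i,1},\dots,g_{i,p_i})$. Standing smoothness assumptions: the maps $y_i\mapsto\theta_i(x,y_i,y_{-i})$ and $y_i\mapsto g_{i,j}(x,y_i)$ are continuously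 differentiable, and the gradients $\nabla_{y_i}\theta_i(x,y_i,y_{-i})$ and $\nabla_{y_i}g_{i,j}(x,y_i)$ are continuous in all of their variables. Nash equilibria. $\mathrm{NEP}(x)$ is the set of $y$ such that, for every $i$, $y_i$ minimizes $\theta_i(x,\cdot,y_{-i})$ over $Y_i(x)$. (SLMFG): minimize $\theta_0(x,y)$ over $(x,y)$ subject to $x\in X$ and $y\in\mathrm{NEP}(x)$. Multiplier sets. $\Lambda_i(x,y)$ is the set of $\mu_i=(\mu_{i,1},\dots,\mu_{i,p_i})\in\mathbb{R}^{p_i}$ such that $$\nabla_{y_i}\theta_i(x,y_i,y_{-i})+\sum_{j=1}^{p_i}\mu_{i,j}\nabla_{y_i}g_{i,j}(x,y_i)=0,\quad g_i(x,y_i)\le 0,\quad \mu_i\ge 0,\quad \langle\mu_i,g_i(x,y_i)\rangle=0,$$ and $\Lambda(x,y)=\prod_{i=1}^n\Lambda_i(x,y)$. (MPCC): minimize $\theta_0(x,y)$ over $(x,y,\mu)$, $\mu=(\mu_1,\dots,\mu_n)\in\prod_i\mathbb{R}^{p_i}$, subject to $x\in X$ and $\mu\in\Lambda(x,y)$. Slater's constraint qualification for follower $i$ at $x$: there is $y_i\in\mathbb{R}^{n_i}$ with $g_{i,j}(x,y_i)<0$ for all $j=1,\dots,p_i$. A local solution of a problem is a feasible point that minimizes the objective among all feasible points in some neighborhood of it; in (MPCC) the neighborhood is taken in the space of triples $(x,y,\mu)$.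
   Formalization: Two assumptions are added, without which the claim is false: each constraint function g_{i,j}(x,y_i) is continuous in x for fixed y_i, and the multiplier set Λ(x̄,ȳ) is nonempty. *)

theory Defs
  imports "HOL-Analysis.Analysis" "HOL-Analysis.Finite_Function_Topology"
begin

text \<open>
  The followers' dimensions \<open>n\<^sub>i\<close> and numbers of constraints \<open>p\<^sub>i\<close> vary with \<open>i\<close>, so
  the spaces cannot be types of the form \<open>real ^ 'n\<close>. The space \<open>\<real>\<^sup>m\<close> is
  instead the subspace of finitely supported sequences vanishing from index \<open>m\<close> on
  (coordinates are \<open>0, \<dots>, m - 1\<close>). The library norm on this type is the sum of the absolute
  values of the coordinates; on \<open>\<real>\<^sup>m\<close> it has the same topology and the same
  derivatives as the Euclidean norm.
\<close>

type_synonym fvec = "nat \<Rightarrow>\<^sub>0 real"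

definition Rn :: "nat \<Rightarrow> fvec set" where
  "Rn m = {v. Poly_Mapping.keys v \<subseteq> {..<m}}"

definition dot :: "nat \<Rightarrow> fvec \<Rightarrow> fvec \<Rightarrow> real" where
  "dot m a b = (\<Sum>k<m. Poly_Mapping.lookup a k * Poly_Mapping.lookup b k)"

text \<open>Derivatives are taken within \<open>Rn m\<close>, so only the values of \<open>f\<close> on \<open>Rn m\<close> matter.\<close>

definition has_gradient :: "nat \<Rightarrow> (fvec \<Rightarrow> real) \<Rightarrow> fvec \<Rightarrow> fvec \<Rightarrow> bool" where
  "has_gradient m f v a \<longleftrightarrow> a \<in> Rn m \<and> (f has_derivative dot m a) (at v within Rn m)"

definition gradient :: "nat \<Rightarrow> (fvec \<Rightarrow> real) \<Rightarrow> fvec \<Rightarrow> fvec" where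
  "gradient m f v = (THE a. has_gradient m f v a)"

text \<open>The definite description in \<open>gradient\<close> picks the unique gradient of a differentiable function.\<close>

lemma lookup_scaleR_fvec [simp]:
  "Poly_Mapping.lookup (c *\<^sub>R v) k = c * Poly_Mapping.lookup (v :: fvec) k"
proof -
  have "finite {i. c *\<^sub>R Poly_Mapping.lookup v i \<noteq> 0}"
    by (rule finite_subset[OF _ finite_keys[of v]]) (auto simp: in_keys_iff)
  then show ?thesis
    by (simp add: scaleR_poly_mapping_def Abs_poly_mapping_inverse)
qed

lemma abs_lookup_le_norm: "\<bar>Poly_Mapping.lookup h k\<bar> \<le> norm (h :: fvec)"
proof (cases "k \<in> Poly_Mapping.keys h")
  case True
  have "norm h = (\<Sum>n\<in>Poly_Mapping.keys h. \<bar>Poly_Mapping.lookup h n\<bar>)"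
    by (simp add: norm_poly_mapping_def dist_poly_mapping_def)
  with True show ?thesis
    using member_le_sum[of k "Poly_Mapping.keys h" "\<lambda>n. \<bar>Poly_Mapping.lookup h n\<bar>"] by simp
qed (simp add: in_keys_iff)

lemma Rn_add: "a \<in> Rn m \<Longrightarrow> b \<in> Rn m \<Longrightarrow> a + b \<in> Rn m"
  unfolding Rn_def using keys_add[of a b] by blast

lemma Rn_scale: "a \<in> Rn m \<Longrightarrow> c *\<^sub>R a \<in> Rn m"
  unfolding Rn_def by (auto simp: in_keys_iff)

lemma lookup_0_Rn: "a \<in> Rn m \<Longrightarrow> k \<ge> m \<Longrightarrow> Poly_Mapping.lookup a k = 0"
  unfolding Rn_def by (force simp: in_keys_iff subset_iff)

lemma single_Rn: "k < m \<Longrightarrow> Poly_Mapping.single k (1::real) \<in> Rn m"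
  unfolding Rn_def by simp

lemma dot_single:
  assumes "k < m"
  shows "dot m a (Poly_Mapping.single k 1) = Poly_Mapping.lookup a k"
proof -
  have "dot m a (Poly_Mapping.single k 1) = (\<Sum>j<m. if k = j then Poly_Mapping.lookup a j else 0)"
    unfolding dot_def by (rule sum.cong) (auto simp: lookup_single)
  then show ?thesis using assms by simp
qed

lemma vec_expand:
  assumes "a \<in> Rn m"
  shows "a = (\<Sum>k<m. Poly_Mapping.lookup a k *\<^sub>R Poly_Mapping.single k 1)"
proof (rule poly_mapping_eqI)
  fix j
  have "Poly_Mapping.lookup (\<Sum>k<m. Poly_Mapping.lookup a k *\<^sub>R Poly_Mapping.single k (1::real)) j
      = (\<Sum>k<m. if j = k then Poly_Mapping.lookup a k else 0)"
    unfolding lookup_sum by (rule sum.cong) (auto simp: lookup_single)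
  then show "Poly_Mapping.lookup a j =
      Poly_Mapping.lookup (\<Sum>k<m. Poly_Mapping.lookup a k *\<^sub>R Poly_Mapping.single k 1) j"
    using lookup_0_Rn[OF assms, of j] by (cases "j < m") simp_all
qed

lemma Rn_direction:
  assumes f: "(f has_derivative D) (at v within Rn m)" and v: "v \<in> Rn m" and h: "h \<in> Rn m"
  shows "((\<lambda>t. f (v + t *\<^sub>R h)) has_derivative (\<lambda>t. D (t *\<^sub>R h))) (at (0::real))"
proof -
  have s: "(\<lambda>t. v + t *\<^sub>R h) ` UNIV \<subseteq> Rn m"
    using v h by (auto intro: Rn_add Rn_scale)
  have l: "((\<lambda>t::real. v + t *\<^sub>R h) has_derivative (\<lambda>t. t *\<^sub>R h)) (at 0 within UNIV)"
    by (auto intro!: derivative_eq_intros)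
  have f': "(f has_derivative D) (at (v + (0::real) *\<^sub>R h) within Rn m)" using f by simp
  show ?thesis
    using has_derivative_in_compose[OF l, of f D] has_derivative_subset[OF f' s] by simp
qed

lemma has_gradient_unique:
  assumes a: "has_gradient m f v a" and b: "has_gradient m f v b" and v: "v \<in> Rn m"
  shows "a = b"
proof (rule poly_mapping_eqI)
  fix k
  show "Poly_Mapping.lookup a k = Poly_Mapping.lookup b k"
  proof (cases "k < m")
    case True
    let ?e = "Poly_Mapping.single k (1::real)"
    have "(\<lambda>t. dot m a (t *\<^sub>R ?e)) = (\<lambda>t. dot m b (t *\<^sub>R ?e))"
      using a b v unfolding has_gradient_def
      by (intro has_derivative_unique[OF Rn_direction Rn_direction]) (auto intro: single_Rn[OF True])
    from fun_cong[OF this, of 1] show ?thesis using True by (simp add: dot_single)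
  next
    case False
    then have "k \<ge> m" by simp
    then show ?thesis using a b lookup_0_Rn[of a m k] lookup_0_Rn[of b m k] by (simp add: has_gradient_def)
  qed
qed

lemma dot_bounded: "bounded_linear (dot m a)"
proof (rule bounded_linear_intro[where K = "\<Sum>k<m. \<bar>Poly_Mapping.lookup a k\<bar>"])
  fix h h' :: fvec and r :: real
  show "dot m a (h + h') = dot m a h + dot m a h'"
    unfolding dot_def by (simp only: lookup_add distrib_left sum.distrib)
  show "dot m a (r *\<^sub>R h) = r *\<^sub>R dot m a h"
    unfolding dot_def
    by (simp only: lookup_scaleR_fvec real_scaleR_def sum_distrib_left mult.left_commute)
  have "\<bar>dot m a h\<bar> \<le> (\<Sum>k<m. norm h * \<bar>Poly_Mapping.lookup a k\<bar>)"
    unfolding dot_def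
  proof (rule order_trans[OF sum_abs sum_mono])
    fix k
    show "\<bar>Poly_Mapping.lookup a k * Poly_Mapping.lookup h k\<bar> \<le> norm h * \<bar>Poly_Mapping.lookup a k\<bar>"
      using mult_right_mono[OF abs_lookup_le_norm[of h k] abs_ge_zero[of "Poly_Mapping.lookup a k"]]
      by (simp only: abs_mult mult.commute)
  qed
  then show "norm (dot m a h) \<le> norm h * (\<Sum>k<m. \<bar>Poly_Mapping.lookup a k\<bar>)"
    by (simp only: real_norm_def sum_distrib_left)
qed

lemma has_gradient_gradient:
  assumes f: "f differentiable (at v within Rn m)" and v: "v \<in> Rn m"
  shows "has_gradient m f v (gradient m f v)"
proof -
  obtain D where D: "(f has_derivative D) (at v within Rn m)"
    using f unfolding differentiable_def by blast
  interpret D: bounded_linear D using D by (rule has_derivative_bounded_linear)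
  define a :: fvec where "a = (\<Sum>k<m. Poly_Mapping.single k (D (Poly_Mapping.single k 1)))"
  have la: "Poly_Mapping.lookup a k = (if k < m then D (Poly_Mapping.single k 1) else 0)" for k
    by (simp add: a_def lookup_sum lookup_single when_def)
  have aR: "a \<in> Rn m" unfolding Rn_def by (auto simp: in_keys_iff la split: if_splits)
  have eq: "D h = dot m a h" if "h \<in> Rn m" for h
  proof -
    have "D h = D (\<Sum>k<m. Poly_Mapping.lookup h k *\<^sub>R Poly_Mapping.single k 1)"
      using vec_expand[OF that] by simp
    then show ?thesis by (simp add: D.sum D.scaleR dot_def la mult.commute)
  qed
  have "(f has_derivative dot m a) (at v within Rn m)"
    unfolding has_derivative_within
  proof (intro conjI dot_bounded)
    have "((\<lambda>y. (1 / norm (y - v)) *\<^sub>R (f y - (f v + D (y - v)))) \<longlongrightarrow> 0) (at v within Rn m)"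
      using D unfolding has_derivative_within by blast
    moreover have "D (y - v) = dot m a (y - v)" if "y \<in> Rn m" for y
      using eq Rn_add[OF that Rn_scale[OF v, of "-1"]] by simp
    ultimately show "((\<lambda>y. (1 / norm (y - v)) *\<^sub>R (f y - (f v + dot m a (y - v)))) \<longlongrightarrow> 0) (at v within Rn m)"
      by (elim Lim_transform_eventually) (auto simp: eventually_at_filter)
  qed
  then have "has_gradient m f v a" using aR by (simp add: has_gradient_def)
  then show ?thesis unfolding gradient_def
    by (rule theI[of "has_gradient m f v"]) (rule has_gradient_unique[OF _ \<open>has_gradient m f v a\<close> v])
qed

text \<open>
  The (finite) type \<open>'i\<close> indexes the followers, \<open>d i\<close> is the dimension \<open>n\<^sub>i\<close> and \<open>p i\<close>
  the number of constraints of follower \<open>i\<close>. The objective \<open>\<theta> i\<close> takes the leader's decision and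
  a full profile \<open>y\<close>, so that \<open>\<theta>\<^sub>i(x, v, y\<^sub>-\<^sub>i)\<close> reads \<open>\<theta> i x (y(i := v))\<close>.
\<close>

definition profiles :: "('i \<Rightarrow> nat) \<Rightarrow> ('i \<Rightarrow> fvec) set" where
  "profiles d = {y. \<forall>i. y i \<in> Rn (d i)}"

definition follower_feasible ::
  "('i \<Rightarrow> nat) \<Rightarrow> ('i \<Rightarrow> nat) \<Rightarrow> ('i \<Rightarrow> nat \<Rightarrow> 'x \<Rightarrow> fvec \<Rightarrow> real) \<Rightarrow> 'i \<Rightarrow> 'x \<Rightarrow> fvec set" where
  "follower_feasible d p g i x = {v \<in> Rn (d i). \<forall>j<p i. g i j x v \<le> 0}"

definition slater ::
  "('i \<Rightarrow> nat) \<Rightarrow> ('i \<Rightarrow> nat) \<Rightarrow> ('i \<Rightarrow> nat \<Rightarrow> 'x \<Rightarrow> fvec \<Rightarrow> real) \<Rightarrow> 'i \<Rightarrow> 'x \<Rightarrow> bool" where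
  "slater d p g i x \<longleftrightarrow> (\<exists>v \<in> Rn (d i). \<forall>j<p i. g i j x v < 0)"

definition NEP ::
  "('i \<Rightarrow> nat) \<Rightarrow> ('i \<Rightarrow> nat) \<Rightarrow> ('i \<Rightarrow> 'x \<Rightarrow> ('i \<Rightarrow> fvec) \<Rightarrow> real) \<Rightarrow>
   ('i \<Rightarrow> nat \<Rightarrow> 'x \<Rightarrow> fvec \<Rightarrow> real) \<Rightarrow> 'x \<Rightarrow> ('i \<Rightarrow> fvec) set" where
  "NEP d p \<theta> g x = {y \<in> profiles d. \<forall>i.
     y i \<in> follower_feasible d p g i x \<and>
     (\<forall>v \<in> follower_feasible d p g i x. \<theta> i x y \<le> \<theta> i x (y(i := v)))}"

definition follower_multipliers ::
  "('i \<Rightarrow> nat) \<Rightarrow> ('i \<Rightarrow> nat) \<Rightarrow> ('i \<Rightarrow> 'x \<Rightarrow> ('i \<Rightarrow> fvec) \<Rightarrow> real) \<Rightarrow>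
   ('i \<Rightarrow> nat \<Rightarrow> 'x \<Rightarrow> fvec \<Rightarrow> real) \<Rightarrow> 'i \<Rightarrow> 'x \<Rightarrow> ('i \<Rightarrow> fvec) \<Rightarrow> fvec set" where
  "follower_multipliers d p \<theta> g i x y = {m \<in> Rn (p i).
     gradient (d i) (\<lambda>v. \<theta> i x (y(i := v))) (y i)
       + (\<Sum>j<p i. Poly_Mapping.lookup m j *\<^sub>R gradient (d i) (g i j x) (y i)) = 0 \<and>
     (\<forall>j<p i. g i j x (y i) \<le> 0) \<and>
     (\<forall>j<p i. 0 \<le> Poly_Mapping.lookup m j) \<and>
     (\<Sum>j<p i. Poly_Mapping.lookup m j * g i j x (y i)) = 0}"

definition multipliers ::
  "('i \<Rightarrow> nat) \<Rightarrow> ('i \<Rightarrow> nat) \<Rightarrow> ('i \<Rightarrow> 'x \<Rightarrow> ('i \<Rightarrow> fvec) \<Rightarrow> real) \<Rightarrow>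
   ('i \<Rightarrow> nat \<Rightarrow> 'x \<Rightarrow> fvec \<Rightarrow> real) \<Rightarrow> 'x \<Rightarrow> ('i \<Rightarrow> fvec) \<Rightarrow> ('i \<Rightarrow> fvec) set" where
  "multipliers d p \<theta> g x y = {\<mu>. \<forall>i. \<mu> i \<in> follower_multipliers d p \<theta> g i x y}"

definition local_solution :: "'a::topological_space set \<Rightarrow> ('a \<Rightarrow> real) \<Rightarrow> 'a \<Rightarrow> bool" where
  "local_solution F f z \<longleftrightarrow>
     z \<in> F \<and> (\<exists>U. open U \<and> z \<in> U \<and> (\<forall>w \<in> F \<inter> U. f z \<le> f w))"

definition SLMFG_feasible ::
  "'x set \<Rightarrow> ('i \<Rightarrow> nat) \<Rightarrow> ('i \<Rightarrow> nat) \<Rightarrow> ('i \<Rightarrow> 'x \<Rightarrow> ('i \<Rightarrow> fvec) \<Rightarrow> real) \<Rightarrow>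
   ('i \<Rightarrow> nat \<Rightarrow> 'x \<Rightarrow> fvec \<Rightarrow> real) \<Rightarrow> ('x \<times> ('i \<Rightarrow> fvec)) set" where
  "SLMFG_feasible X d p \<theta> g = {(x, y). x \<in> X \<and> y \<in> NEP d p \<theta> g x}"

definition SLMFG_local_solution ::
  "('x::topological_space) set \<Rightarrow> ('x \<Rightarrow> ('i \<Rightarrow> fvec) \<Rightarrow> real) \<Rightarrow> ('i \<Rightarrow> nat) \<Rightarrow> ('i \<Rightarrow> nat) \<Rightarrow>
   ('i \<Rightarrow> 'x \<Rightarrow> ('i \<Rightarrow> fvec) \<Rightarrow> real) \<Rightarrow> ('i \<Rightarrow> nat \<Rightarrow> 'x \<Rightarrow> fvec \<Rightarrow> real) \<Rightarrow>
   'x \<Rightarrow> ('i \<Rightarrow> fvec) \<Rightarrow> bool" where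
  "SLMFG_local_solution X \<theta>0 d p \<theta> g x y \<longleftrightarrow>
     local_solution (SLMFG_feasible X d p \<theta> g) (\<lambda>(x, y). \<theta>0 x y) (x, y)"

definition MPCC_feasible ::
  "'x set \<Rightarrow> ('i \<Rightarrow> nat) \<Rightarrow> ('i \<Rightarrow> nat) \<Rightarrow> ('i \<Rightarrow> 'x \<Rightarrow> ('i \<Rightarrow> fvec) \<Rightarrow> real) \<Rightarrow>
   ('i \<Rightarrow> nat \<Rightarrow> 'x \<Rightarrow> fvec \<Rightarrow> real) \<Rightarrow> ('x \<times> ('i \<Rightarrow> fvec) \<times> ('i \<Rightarrow> fvec)) set" where
  "MPCC_feasible X d p \<theta> g =
     {(x, y, \<mu>). x \<in> X \<and> y \<in> profiles d \<and> \<mu> \<in> multipliers d p \<theta> g x y}"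

definition MPCC_local_solution ::
  "('x::topological_space) set \<Rightarrow> ('x \<Rightarrow> ('i \<Rightarrow> fvec) \<Rightarrow> real) \<Rightarrow> ('i \<Rightarrow> nat) \<Rightarrow> ('i \<Rightarrow> nat) \<Rightarrow>
   ('i \<Rightarrow> 'x \<Rightarrow> ('i \<Rightarrow> fvec) \<Rightarrow> real) \<Rightarrow> ('i \<Rightarrow> nat \<Rightarrow> 'x \<Rightarrow> fvec \<Rightarrow> real) \<Rightarrow>
   'x \<Rightarrow> ('i \<Rightarrow> fvec) \<Rightarrow> ('i \<Rightarrow> fvec) \<Rightarrow> bool" where
  "MPCC_local_solution X \<theta>0 d p \<theta> g x y \<mu> \<longleftrightarrow>
     local_solution (MPCC_feasible X d p \<theta> g) (\<lambda>(x, y, \<mu>). \<theta>0 x y) (x, y, \<mu>)"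

text \<open>
  The third conjunct, continuity in all variables, contains the continuity of the gradients in
  \<open>y\<^sub>i\<close> required for continuous differentiability; likewise the last one.
\<close>

definition smooth_followers ::
  "('i \<Rightarrow> nat) \<Rightarrow> ('i \<Rightarrow> nat) \<Rightarrow> ('i \<Rightarrow> ('x::topological_space) \<Rightarrow> ('i \<Rightarrow> fvec) \<Rightarrow> real) \<Rightarrow>
   ('i \<Rightarrow> nat \<Rightarrow> 'x \<Rightarrow> fvec \<Rightarrow> real) \<Rightarrow> bool" where
  "smooth_followers d p \<theta> g \<longleftrightarrow> (\<forall>i.
     (\<forall>x. \<forall>y \<in> profiles d. (\<lambda>v. \<theta> i x (y(i := v))) differentiable_on Rn (d i)) \<and>
     (\<forall>j<p i. \<forall>x. g i j x differentiable_on Rn (d i)) \<and>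
     continuous_on (UNIV \<times> profiles d)
       (\<lambda>(x, y). gradient (d i) (\<lambda>v. \<theta> i x (y(i := v))) (y i)) \<and>
     (\<forall>j<p i. continuous_on (UNIV \<times> Rn (d i)) (\<lambda>(x, v). gradient (d i) (g i j x) v)))"

definition convex_followers ::
  "('i \<Rightarrow> nat) \<Rightarrow> ('i \<Rightarrow> nat) \<Rightarrow> ('i \<Rightarrow> 'x \<Rightarrow> ('i \<Rightarrow> fvec) \<Rightarrow> real) \<Rightarrow>
   ('i \<Rightarrow> nat \<Rightarrow> 'x \<Rightarrow> fvec \<Rightarrow> real) \<Rightarrow> bool" where
  "convex_followers d p \<theta> g \<longleftrightarrow> (\<forall>i.
     (\<forall>x. \<forall>y \<in> profiles d. convex_on (Rn (d i)) (\<lambda>v. \<theta> i x (y(i := v)))) \<and>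
     (\<forall>j<p i. \<forall>x. convex_on (Rn (d i)) (g i j x)))"

end

theory Submission
  imports Defs
begin

text \<open>
  For a convex game, \<open>y\<close> is a Nash equilibrium at \<open>x\<close> as soon as it has multipliers
  (\<open>multipliers_imp_NEP\<close>), and under Slater's condition every equilibrium has them
  (\<open>NEP_imp_multipliers\<close>). In particular \<open>(xbar, ybar)\<close> is feasible for the game. A feasible point of
  the game near \<open>(xbar, ybar)\<close> thus extends to a feasible point of the MPCC, but the MPCC solutions
  \<open>(xbar, ybar, \<mu>)\<close> are minimal only in neighbourhoods that depend on \<open>\<mu>\<close>, so it must be shown that the
  multipliers of the nearby point can be taken close to some multiplier of \<open>(xbar, ybar)\<close>.

  This is a compactness argument. Suppose that feasible points \<open>(x k, y k)\<close> of the game converge to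
  \<open>(xbar, ybar)\<close> and have smaller leader's cost. Slater's condition at \<open>xbar\<close> persists at \<open>x k\<close> with the
  same Slater points, so multipliers \<open>\<mu> k\<close> exist, and the strict inequalities at those points bound them
  uniformly (\<open>multipliers_bounded\<close>). A subsequence converges, and its limit \<open>L\<close> is a multiplier of
  \<open>(xbar, ybar)\<close> (\<open>multipliers_closed\<close>). Since \<open>(xbar, ybar, L)\<close> is a local solution of the MPCC, the points
  \<open>(x k, y k, \<mu> k)\<close> of the subsequence eventually cannot have smaller cost, a contradiction.

  The necessity of the KKT conditions is derived from Gordan's theorem of the alternative
  (\<open>gordan\<close>, \<open>fritz_john\<close>, \<open>minimum_imp_kkt\<close>).
\<close>

section \<open>The pairing on \<open>\<real>\<^sup>m\<close>\<close>

lemma dot_commute: "dot m a b = dot m b a"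
  unfolding dot_def by (rule sum.cong) (simp_all only: mult.commute)

lemma dot_add_left: "dot m (a + b) c = dot m a c + dot m b c"
  unfolding dot_def by (simp only: lookup_add distrib_right sum.distrib)

lemma dot_scaleR_left: "dot m (r *\<^sub>R a) c = r * dot m a c"
  unfolding dot_def by (simp only: lookup_scaleR_fvec sum_distrib_left mult.assoc)

lemma dot_zero_left: "dot m 0 c = 0"
  unfolding dot_def by simp

lemma dot_sum_left: "dot m (\<Sum>j\<in>A. f j) c = (\<Sum>j\<in>A. dot m (f j) c)"
  by (induction A rule: infinite_finite_induct) (simp_all add: dot_zero_left dot_add_left)

lemma dot_scaleR_right: "dot m c (r *\<^sub>R a) = r * dot m c a"
  by (simp add: dot_commute[of m c] dot_scaleR_left)

lemma dot_zero_right: "dot m c 0 = 0"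
  by (simp add: dot_commute[of m c] dot_zero_left)

lemma dot_add_right: "dot m c (a + b) = dot m c a + dot m c b"
  by (simp add: dot_commute[of m c] dot_add_left)

text \<open>
  The norm of the vector type is a sum of absolute values; positive definiteness lets \<open>dot\<close> supply
  the Euclidean geometry of \<open>\<real>\<^sup>m\<close> instead.
\<close>

lemma dot_self_pos:
  assumes "a \<in> Rn m" "a \<noteq> 0"
  shows "dot m a a > 0"
proof -
  obtain k where k: "Poly_Mapping.lookup a k \<noteq> 0"
    using assms(2) by (metis lookup_zero poly_mapping_eqI)
  then have "k < m" using lookup_0_Rn[OF assms(1)] by (meson not_le)
  then show ?thesis unfolding dot_def using k
    by (intro sum_pos2[of _ k]) (auto simp: zero_less_mult_iff linorder_neq_iff)
qed

lemma Rn_diff: "a \<in> Rn m \<Longrightarrow> b \<in> Rn m \<Longrightarrow> a - b \<in> Rn m"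
  using Rn_add[of a m "- 1 *\<^sub>R b"] Rn_scale[of b m "-1"] by simp

lemma convex_Rn: "convex (Rn m)"
  by (intro convexI Rn_add Rn_scale)

lemma bounded_linear_lookup: "bounded_linear (\<lambda>v :: fvec. Poly_Mapping.lookup v k)"
  by (rule bounded_linear_intro[where K = 1]) (simp_all add: lookup_add abs_lookup_le_norm)

lemmas tendsto_lookup [tendsto_intros] = bounded_linear.tendsto[OF bounded_linear_lookup]

lemma tendsto_dot [tendsto_intros]:
  assumes "(a \<longlongrightarrow> A) F" "(b \<longlongrightarrow> B) F"
  shows "((\<lambda>k. dot m (a k) (b k)) \<longlongrightarrow> dot m A B) F"
  unfolding dot_def by (intro tendsto_intros assms)

lemma continuous_on_dot_self: "continuous_on S (\<lambda>a. dot m a a)"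
  unfolding continuous_on_def by (auto intro!: tendsto_intros)

section \<open>Optimality conditions for convex programs\<close>

text \<open>
  A theorem of the alternative. Let \<open>a\<close> be the point of the convex hull of the vectors that is
  closest to the origin for \<open>dot\<close>; it exists because the hull of finitely many points is compact.
  By minimality all vectors satisfy \<open>dot m (\<phi> k) a \<ge> dot m a a\<close>. If \<open>a\<close> were nonzero, \<open>- a\<close> would
  therefore form an obtuse angle with each of them. So the hull contains \<open>0\<close>.
\<close>

lemma gordan:
  fixes \<phi> :: "'k \<Rightarrow> fvec"
  assumes I: "finite I" "I \<noteq> {}" and \<phi>: "\<And>k. k \<in> I \<Longrightarrow> \<phi> k \<in> Rn m"
    and no_dir: "\<not> (\<exists>h \<in> Rn m. \<forall>k\<in>I. dot m (\<phi> k) h < 0)"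
  shows "\<exists>u. (\<forall>k\<in>I. 0 \<le> u k) \<and> sum u I = 1 \<and> (\<Sum>k\<in>I. u k *\<^sub>R \<phi> k) = 0"
proof -
  let ?H = "convex hull (\<phi> ` I)"
  have HR: "?H \<subseteq> Rn m"
    using \<phi> by (intro hull_minimal convex_Rn) auto
  have "compact ?H" using I by (intro finite_imp_compact_convex_hull) simp
  then obtain a where a: "a \<in> ?H" and min: "\<And>b. b \<in> ?H \<Longrightarrow> dot m a a \<le> dot m b b"
    using continuous_attains_inf[OF _ _ continuous_on_dot_self[of ?H m]] I by auto
  have aR: "a \<in> Rn m" using a HR by blast
  have "dot m (\<phi> k) a \<ge> dot m a a" if k: "k \<in> I" for k
  proof (rule ccontr)
    let ?e = "\<phi> k - a"
    assume "\<not> dot m (\<phi> k) a \<ge> dot m a a"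
    then have neg: "dot m ?e a < 0"
      using dot_add_left[of m ?e a a] by simp
    \<comment> \<open>Moving from \<open>a\<close> towards \<open>\<phi> k\<close> stays in the hull and first decreases the quadratic form.\<close>
    have q: "dot m (a + t *\<^sub>R ?e) (a + t *\<^sub>R ?e) = dot m a a + 2 * t * dot m ?e a + t * t * dot m ?e ?e"
      for t :: real
      unfolding dot_add_left dot_add_right dot_scaleR_left dot_scaleR_right dot_commute[of m a ?e]
      by (simp add: algebra_simps)
    have "((\<lambda>t::real. dot m (a + t *\<^sub>R ?e) (a + t *\<^sub>R ?e)) has_real_derivative 2 * dot m ?e a) (at 0)"
      unfolding q by (auto intro!: derivative_eq_intros)
    from DERIV_neg_dec_right[OF this] neg obtain \<delta> where "\<delta> > 0"
      and \<delta>: "\<And>t. 0 < t \<Longrightarrow> t < \<delta> \<Longrightarrow>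
        dot m (a + t *\<^sub>R ?e) (a + t *\<^sub>R ?e) < dot m a a"
      by auto
    define t where "t = min (\<delta> / 2) 1"
    have t: "0 < t" "t < \<delta>" "t \<le> 1" using \<open>\<delta> > 0\<close> by (auto simp: t_def min_def)
    have "(1 - t) *\<^sub>R a + t *\<^sub>R \<phi> k \<in> ?H"
      using convex_convex_hull a k t by (intro convexD) (auto intro: hull_inc)
    moreover have "(1 - t) *\<^sub>R a + t *\<^sub>R \<phi> k = a + t *\<^sub>R ?e" by (simp add: algebra_simps)
    ultimately show False using min[of "a + t *\<^sub>R ?e"] \<delta>[OF t(1,2)] by simp
  qed
  moreover have "\<not> (\<forall>k\<in>I. dot m (\<phi> k) (- 1 *\<^sub>R a) < 0)"
    using no_dir Rn_scale[OF aR, of "-1"] by blast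
  ultimately have "a = 0"
    using dot_self_pos[OF aR] unfolding dot_scaleR_right by force
  then obtain w where w: "\<forall>x\<in>\<phi> ` I. 0 \<le> w x" "sum w (\<phi> ` I) = 1" "(\<Sum>x\<in>\<phi> ` I. w x *\<^sub>R x) = 0"
    using a convex_hull_finite[of "\<phi> ` I"] I(1) by auto
  \<comment> \<open>The hull is taken over a set of vectors. Different indices may carry the same vector, so its weight
    goes to a single one of them.\<close>
  obtain J where J: "J \<subseteq> I" "inj_on \<phi> J" "\<phi> ` J = \<phi> ` I"
    using subset_image_inj[of "\<phi> ` I" \<phi> I] by auto
  define u where "u k = (if k \<in> J then w (\<phi> k) else 0)" for k
  have "sum u I = sum u J" "(\<Sum>k\<in>I. u k *\<^sub>R \<phi> k) = (\<Sum>k\<in>J. u k *\<^sub>R \<phi> k)"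
    by (rule sum.mono_neutral_right; use I J in \<open>simp add: u_def\<close>)+
  moreover have "sum u J = 1" "(\<Sum>k\<in>J. u k *\<^sub>R \<phi> k) = 0"
    using w(2,3) unfolding J(3)[symmetric] by (simp_all add: sum.reindex[OF J(2)] u_def)
  ultimately show ?thesis using w(1) J(1) by (intro exI[of _ u]) (auto simp: u_def)
qed

lemma has_gradient_DERIV:
  assumes "has_gradient m f v a" "v \<in> Rn m" "h \<in> Rn m"
  shows "((\<lambda>t. f (v + t *\<^sub>R h)) has_real_derivative dot m a h) (at 0)"
  using Rn_direction[of f "dot m a" v m h] assms
  by (simp add: has_gradient_def has_field_derivative_def dot_scaleR_right mult.commute[of _ "dot m a h"])

lemma eventually_descent:
  assumes "has_gradient m f v a" "v \<in> Rn m" "h \<in> Rn m" "dot m a h < 0"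
  shows "\<forall>\<^sub>F t in at_right 0. f (v + t *\<^sub>R h) < f v"
  using DERIV_neg_dec_right[OF has_gradient_DERIV[OF assms(1-3)] assms(4)]
  unfolding eventually_at_right_field by auto

text \<open>
  On the segment from \<open>v\<close> to \<open>w\<close> a convex function lies below its chord, so its slope at \<open>v\<close> in the
  direction \<open>w - v\<close> cannot exceed the slope \<open>f w - f v\<close> of that chord.
\<close>

lemma gradient_inequality:
  assumes cvx: "convex_on (Rn m) f" and grad: "has_gradient m f v a"
    and v: "v \<in> Rn m" and w: "w \<in> Rn m"
  shows "f v + dot m a (w - v) \<le> f w"
proof (rule ccontr)
  assume "\<not> ?thesis"
  then have pos: "dot m a (w - v) - (f w - f v) > 0" by simp
  have "((\<lambda>t. f (v + t *\<^sub>R (w - v)) - t * (f w - f v)) has_real_derivative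
      dot m a (w - v) - (f w - f v)) (at 0)"
    by (auto intro!: derivative_eq_intros has_gradient_DERIV grad v w Rn_diff)
  from DERIV_pos_inc_right[OF this pos] obtain \<delta> where "\<delta> > 0" and
    \<delta>: "\<And>t. 0 < t \<Longrightarrow> t < \<delta> \<Longrightarrow> f v < f (v + t *\<^sub>R (w - v)) - t * (f w - f v)" by auto
  define t where "t = min (\<delta> / 2) 1"
  have t: "0 < t" "t < \<delta>" "t \<le> 1" using \<open>\<delta> > 0\<close> by (auto simp: t_def min_def)
  have "v + t *\<^sub>R (w - v) = (1 - t) *\<^sub>R v + t *\<^sub>R w" by (simp add: algebra_simps)
  then show False
    using convex_onD[OF cvx, of t v w] t v w \<delta>[OF t(1,2)] by (simp add: algebra_simps)
qed

text \<open>
  A direction in which the objective and all active constraints decrease to first order would lead to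
  better feasible points: inactive constraints stay negative by continuity. So there is no such
  direction, and Gordan's alternative gives the multipliers. The index \<open>None\<close> stands for the objective
  and \<open>Some j\<close> for constraint \<open>j\<close>. The weight \<open>l0\<close> of the objective may still be \<open>0\<close>; excluding this is
  the role of Slater's condition.
\<close>

lemma fritz_john:
  fixes f :: "fvec \<Rightarrow> real" and g :: "nat \<Rightarrow> fvec \<Rightarrow> real"
  assumes v: "v \<in> Rn m" and f: "has_gradient m f v a"
    and g: "\<And>j. j < p \<Longrightarrow> has_gradient m (g j) v (b j)"
    and feas: "\<And>j. j < p \<Longrightarrow> g j v \<le> 0"
    and opt: "\<And>w. w \<in> Rn m \<Longrightarrow> \<forall>j<p. g j w \<le> 0 \<Longrightarrow> f v \<le> f w"
  obtains l0 l where "0 \<le> l0" "\<forall>j<p. 0 \<le> l j" "l0 + (\<Sum>j<p. l j) = (1::real)"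
    "l0 *\<^sub>R a + (\<Sum>j<p. l j *\<^sub>R b j) = 0" "\<forall>j<p. l j * g j v = 0"
proof -
  define J where "J = {j \<in> {..<p}. g j v = 0}"
  define \<phi> where "\<phi> = case_option a b"
  let ?I = "insert None (Some ` J)"
  have J: "finite J" "J \<subseteq> {..<p}" by (auto simp: J_def)
  have "\<not> (\<exists>h \<in> Rn m. \<forall>k\<in>?I. dot m (\<phi> k) h < 0)"
  proof
    assume "\<exists>h \<in> Rn m. \<forall>k\<in>?I. dot m (\<phi> k) h < 0"
    then obtain h where h: "h \<in> Rn m" "dot m a h < 0" "\<And>j. j \<in> J \<Longrightarrow> dot m (b j) h < 0"
      by (auto simp: \<phi>_def)
    have "\<forall>\<^sub>F t in at_right 0. g j (v + t *\<^sub>R h) < 0" if j: "j < p" for j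
    proof (cases "j \<in> J")
      case True
      then show ?thesis
        using eventually_descent[OF g[OF j] v h(1) h(3)] by (simp add: J_def)
    next
      case False
      have "((\<lambda>t. g j (v + t *\<^sub>R h)) \<longlongrightarrow> g j v) (at 0)"
        using DERIV_isCont[OF has_gradient_DERIV[OF g[OF j] v h(1)]] by (simp add: isCont_def)
      moreover have "g j v < 0" using False feas[OF j] j by (auto simp: J_def)
      ultimately show ?thesis
        by (intro order_tendstoD(2)[of _ "g j v"]) (auto intro: filterlim_at_split[THEN iffD1, THEN conjunct2])
    qed
    then have "\<forall>\<^sub>F t in at_right 0. \<forall>j\<in>{..<p}. g j (v + t *\<^sub>R h) < 0"
      by (intro eventually_ball_finite) auto
    then have "\<forall>\<^sub>F t in at_right 0. f (v + t *\<^sub>R h) < f v \<and> (\<forall>j\<in>{..<p}. g j (v + t *\<^sub>R h) < 0)"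
      using eventually_descent[OF f v h(1,2)] by (rule eventually_conj[rotated])
    then obtain t where "f (v + t *\<^sub>R h) < f v" "\<forall>j<p. g j (v + t *\<^sub>R h) < 0"
      using eventually_happens'[OF trivial_limit_at_right_real] by force
    then show False
      using opt[of "v + t *\<^sub>R h"] Rn_add[OF v Rn_scale[OF h(1)]] by (force intro: less_imp_le)
  qed
  moreover have "\<phi> k \<in> Rn m" if "k \<in> ?I" for k
    using that f g J by (auto simp: \<phi>_def has_gradient_def)
  ultimately obtain u where u: "\<forall>k\<in>?I. 0 \<le> u k" "sum u ?I = 1" "(\<Sum>k\<in>?I. u k *\<^sub>R \<phi> k) = 0"
    using gordan[of ?I \<phi> m] J(1) by auto
  define l where "l j = (if j \<in> J then u (Some j) else 0)" for j
  have "(\<Sum>j<p. l j) = (\<Sum>j\<in>J. u (Some j))" "(\<Sum>j<p. l j *\<^sub>R b j) = (\<Sum>j\<in>J. u (Some j) *\<^sub>R b j)"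
    using J by (auto intro!: sum.mono_neutral_cong_right simp: l_def)
  moreover have "u None + (\<Sum>j\<in>J. u (Some j)) = 1" "u None *\<^sub>R a + (\<Sum>j\<in>J. u (Some j) *\<^sub>R b j) = 0"
    using u(2,3) J(1) by (simp_all add: sum.reindex \<phi>_def image_iff)
  ultimately show ?thesis
    using u(1) by (intro that[of "u None" l]) (auto simp: l_def J_def)
qed


text \<open>
  Pairing the stationarity equation with \<open>w - v\<close> and using the gradient inequality of each constraint.
  Three facts rest on this bound: taken at a feasible \<open>w\<close> it gives sufficiency of the KKT conditions,
  and taken at a Slater point it bounds the multipliers and, with \<open>a = 0\<close>, excludes a vanishing
  multiplier of the objective.
\<close>

lemma constraint_combination_lower_bound:
  assumes v: "v \<in> Rn m" and w: "w \<in> Rn m"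
    and g: "\<And>j. j < p \<Longrightarrow> has_gradient m (g j) v (b j)" "\<And>j. j < p \<Longrightarrow> convex_on (Rn m) (g j)"
    and l: "\<And>j. j < p \<Longrightarrow> 0 \<le> l j" "(\<Sum>j<p. l j * g j v) = 0"
    and stationary: "a + (\<Sum>j<p. l j *\<^sub>R b j) = 0"
  shows "- dot m a (w - v) \<le> (\<Sum>j<p. l j * g j w)"
proof -
  have "0 = dot m a (w - v) + (\<Sum>j<p. l j * dot m (b j) (w - v))"
    using arg_cong[OF stationary, of "\<lambda>c. dot m c (w - v)"]
    by (simp add: dot_add_left dot_sum_left dot_scaleR_left dot_zero_left)
  then have "- dot m a (w - v) = (\<Sum>j<p. l j * g j v) + (\<Sum>j<p. l j * dot m (b j) (w - v))"
    using l(2) by simp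
  also have "\<dots> = (\<Sum>j<p. l j * (g j v + dot m (b j) (w - v)))"
    by (simp add: distrib_left sum.distrib)
  also have "\<dots> \<le> (\<Sum>j<p. l j * g j w)"
    using gradient_inequality[OF g(2) g(1) v w] l(1)
    by (intro sum_mono mult_left_mono) auto
  finally show ?thesis .
qed

lemma kkt_imp_minimum:
  assumes v: "v \<in> Rn m" and w: "w \<in> Rn m" "\<And>j. j < p \<Longrightarrow> g j w \<le> 0"
    and f: "has_gradient m f v a" "convex_on (Rn m) f"
    and g: "\<And>j. j < p \<Longrightarrow> has_gradient m (g j) v (b j)" "\<And>j. j < p \<Longrightarrow> convex_on (Rn m) (g j)"
    and l: "\<And>j. j < p \<Longrightarrow> 0 \<le> l j" "(\<Sum>j<p. l j * g j v) = 0"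
    and stationary: "a + (\<Sum>j<p. l j *\<^sub>R b j) = 0"
  shows "f v \<le> f w"
proof -
  have "(\<Sum>j<p. l j * g j w) \<le> 0"
    using l(1) w(2) by (intro sum_nonpos mult_nonneg_nonpos) auto
  then show ?thesis
    using constraint_combination_lower_bound[OF v w(1) g l stationary]
      gradient_inequality[OF f(2,1) v w(1)] by simp
qed

text \<open>
  Divide the Fritz John multipliers by that of the objective. If the latter vanished, some constraint
  multiplier would be positive, so the combination of the constraints would be negative at the Slater
  point, against its lower bound \<open>0\<close>.
\<close>

lemma minimum_imp_kkt:
  fixes f :: "fvec \<Rightarrow> real" and g :: "nat \<Rightarrow> fvec \<Rightarrow> real"
  assumes v: "v \<in> Rn m" and f: "has_gradient m f v a"
    and g: "\<And>j. j < p \<Longrightarrow> has_gradient m (g j) v (b j)" "\<And>j. j < p \<Longrightarrow> convex_on (Rn m) (g j)"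
    and feas: "\<And>j. j < p \<Longrightarrow> g j v \<le> 0"
    and opt: "\<And>w. w \<in> Rn m \<Longrightarrow> \<forall>j<p. g j w \<le> 0 \<Longrightarrow> f v \<le> f w"
    and slater: "s \<in> Rn m" "\<And>j. j < p \<Longrightarrow> g j s < 0"
  obtains l where "\<forall>j<p. 0 \<le> l j" "(\<Sum>j<p. l j * g j v) = 0"
    "a + (\<Sum>j<p. l j *\<^sub>R b j) = 0"
proof -
  obtain l0 l where
    l0: "0 \<le> l0" and nonneg: "\<forall>j<p. 0 \<le> l j" and norm: "l0 + (\<Sum>j<p. l j) = (1::real)"
    and stat: "l0 *\<^sub>R a + (\<Sum>j<p. l j *\<^sub>R b j) = 0" and compl: "\<forall>j<p. l j * g j v = 0"
    by (rule fritz_john[where p = p and g = g, OF v f g(1) feas opt])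
  note l = nonneg[rule_format]
  have "l0 \<noteq> 0"
  proof
    assume "l0 = 0"
    then have "0 + (\<Sum>j<p. l j *\<^sub>R b j) = 0" "(\<Sum>j<p. l j) = 1" using stat norm by simp_all
    then have "0 \<le> (\<Sum>j<p. l j * g j s)"
      using constraint_combination_lower_bound[where p = p and g = g and l = l and a = 0, OF v slater(1) g l] compl
      by (simp add: dot_zero_left)
    moreover obtain k where "k < p" "l k > 0"
      using \<open>(\<Sum>j<p. l j) = 1\<close> l sum_nonpos[of "{..<p}" l] by (force simp: not_less)
    then have "0 < (\<Sum>j<p. - (l j * g j s))"
      using slater(2) l by (intro sum_pos2[of _ k]) (auto intro: mult_pos_neg mult_nonneg_nonpos less_imp_le)
    ultimately show False by (simp add: sum_negf)
  qed
  show ?thesis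
  proof (rule that[of "\<lambda>j. l j / l0"])
    show "(\<Sum>j<p. l j / l0 * g j v) = 0" using compl by (intro sum.neutral) auto
    have "(1 / l0) *\<^sub>R (l0 *\<^sub>R a + (\<Sum>j<p. l j *\<^sub>R b j)) = 0" using stat by simp
    then show "a + (\<Sum>j<p. (l j / l0) *\<^sub>R b j) = 0"
      using \<open>l0 \<noteq> 0\<close> by (simp add: scaleR_add_right scaleR_sum_right)
  qed (use l l0 in simp)
qed

section \<open>Nash equilibria and multipliers\<close>

lemma has_gradient_objective:
  assumes "smooth_followers d p \<theta> g" "y \<in> profiles d"
  shows "has_gradient (d i) (\<lambda>v. \<theta> i x (y(i := v))) (y i) (gradient (d i) (\<lambda>v. \<theta> i x (y(i := v))) (y i))"
  using assms unfolding smooth_followers_def differentiable_on_def profiles_def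
  by (intro has_gradient_gradient) blast+

lemma has_gradient_constraint:
  assumes "smooth_followers d p \<theta> g" "j < p i" "v \<in> Rn (d i)"
  shows "has_gradient (d i) (g i j x) v (gradient (d i) (g i j x) v)"
  using assms unfolding smooth_followers_def differentiable_on_def
  by (intro has_gradient_gradient) blast+

lemma multipliers_imp_NEP:
  assumes smooth: "smooth_followers d p \<theta> g" and convex: "convex_followers d p \<theta> g"
    and y: "y \<in> profiles d" and \<mu>: "\<mu> \<in> multipliers d p \<theta> g x y"
  shows "y \<in> NEP d p \<theta> g x"
  unfolding NEP_def
proof (intro CollectI conjI allI ballI y)
  fix i
  have yi: "y i \<in> Rn (d i)" using y by (simp add: profiles_def)
  have m: "\<mu> i \<in> follower_multipliers d p \<theta> g i x y" using \<mu> by (simp add: multipliers_def)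
  then show "y i \<in> follower_feasible d p g i x"
    using yi by (simp add: follower_multipliers_def follower_feasible_def)
  fix v assume v: "v \<in> follower_feasible d p g i x"
  have cf: "convex_on (Rn (d i)) (\<lambda>v. \<theta> i x (y(i := v)))"
    and cg: "\<And>j. j < p i \<Longrightarrow> convex_on (Rn (d i)) (g i j x)"
    using convex y by (simp_all add: convex_followers_def)
  have "\<theta> i x (y(i := y i)) \<le> \<theta> i x (y(i := v))"
    using v m
    by (intro kkt_imp_minimum[where f = "\<lambda>v. \<theta> i x (y(i := v))" and g = "\<lambda>j. g i j x" and p = "p i"
          and l = "Poly_Mapping.lookup (\<mu> i)", OF yi _ _ has_gradient_objective[OF smooth y] cf
          has_gradient_constraint[where p = p, OF smooth _ yi] cg])
      (simp_all add: follower_feasible_def follower_multipliers_def)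
  then show "\<theta> i x y \<le> \<theta> i x (y(i := v))" by simp
qed

lemma NEP_imp_multipliers:
  assumes smooth: "smooth_followers d p \<theta> g" and convex: "convex_followers d p \<theta> g"
    and y: "y \<in> NEP d p \<theta> g x" and slater: "\<And>i. slater d p g i x"
  obtains \<mu> where "\<mu> \<in> multipliers d p \<theta> g x y"
proof -
  have "\<exists>m. m \<in> follower_multipliers d p \<theta> g i x y" for i
  proof -
    let ?a = "gradient (d i) (\<lambda>v. \<theta> i x (y(i := v))) (y i)"
    let ?b = "\<lambda>j. gradient (d i) (g i j x) (y i)"
    have yp: "y \<in> profiles d" and yi: "y i \<in> Rn (d i)" using y by (auto simp: NEP_def profiles_def)
    obtain s where s: "s \<in> Rn (d i)" "\<And>j. j < p i \<Longrightarrow> g i j x s < 0"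
      using slater[of i] by (auto simp: slater_def)
    have feas: "g i j x (y i) \<le> 0" if "j < p i" for j
      using y that by (auto simp: NEP_def follower_feasible_def)
    have opt: "\<theta> i x (y(i := y i)) \<le> \<theta> i x (y(i := v))" if "v \<in> Rn (d i)" "\<forall>j<p i. g i j x v \<le> 0" for v
      using y that by (auto simp: NEP_def follower_feasible_def)
    have cg: "convex_on (Rn (d i)) (g i j x)" if "j < p i" for j
      using convex that by (simp add: convex_followers_def)
    obtain l where l: "\<forall>j<p i. 0 \<le> l j" "(\<Sum>j<p i. l j * g i j x (y i)) = 0"
      "?a + (\<Sum>j<p i. l j *\<^sub>R ?b j) = 0"
      by (rule minimum_imp_kkt[where f = "\<lambda>v. \<theta> i x (y(i := v))" and g = "\<lambda>j. g i j x" and p = "p i",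
          OF yi has_gradient_objective[OF smooth yp] has_gradient_constraint[where p = p, OF smooth _ yi]
          cg feas opt s])
    define m :: fvec where "m = (\<Sum>j<p i. Poly_Mapping.single j (l j))"
    have lm: "Poly_Mapping.lookup m j = (if j < p i then l j else 0)" for j
      by (simp add: m_def lookup_sum lookup_single when_def)
    have "m \<in> Rn (p i)" unfolding Rn_def by (auto simp: in_keys_iff lm split: if_splits)
    then show ?thesis
      using l feas by (auto simp: follower_multipliers_def lm)
  qed
  then obtain \<mu> where "\<And>i. \<mu> i \<in> follower_multipliers d p \<theta> g i x y" by metis
  then show ?thesis by (intro that[of \<mu>]) (simp add: multipliers_def)
qed

section \<open>Compactness of multipliers under Slater's condition\<close>

text \<open>
  The vector type itself is infinite-dimensional, so bounded sets need not be relatively compact.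
  The vectors in question are the convex combinations of \<open>0\<close> and the points \<open>C *\<^sub>R single k 1\<close> with
  \<open>k < m\<close>, and the convex hull of finitely many points is compact.
\<close>

lemma bounded_nonneg_vectors_in_compact:
  assumes "C > 0"
  obtains K :: "fvec set" where "compact K"
    "{v \<in> Rn m. (\<forall>j<m. 0 \<le> Poly_Mapping.lookup v j) \<and> (\<Sum>j<m. Poly_Mapping.lookup v j) \<le> C} \<subseteq> K"
proof -
  define e :: "nat \<Rightarrow> fvec" where "e k = (if k < m then C *\<^sub>R Poly_Mapping.single k 1 else 0)" for k
  have "v \<in> convex hull (e ` {..m})"
    if v: "v \<in> Rn m" "\<forall>j<m. 0 \<le> Poly_Mapping.lookup v j" "(\<Sum>j<m. Poly_Mapping.lookup v j) \<le> C" for v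
  proof -
    let ?l = "Poly_Mapping.lookup v"
    \<comment> \<open>The index \<open>m\<close> carries the vertex \<open>0\<close>, which takes the remaining weight.\<close>
    define c where "c k = (if k < m then ?l k / C else 1 - (\<Sum>j<m. ?l j) / C)" for k
    have split: "{..m} = insert m {..<m}" by auto
    have "v = (\<Sum>k<m. c k *\<^sub>R e k)"
      using assms by (subst vec_expand[OF v(1)]) (intro sum.cong, auto simp: c_def e_def)
    also have "\<dots> = (\<Sum>k\<le>m. c k *\<^sub>R e k)"
      by (simp add: split e_def)
    also have "\<dots> \<in> convex hull (e ` {..m})"
    proof (intro convex_sum convex_convex_hull)
      show "sum c {..m} = 1"
        by (simp add: split c_def sum_divide_distrib)
      show "0 \<le> c k" for k
        using v assms by (simp add: c_def)
    qed (auto intro: hull_inc)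
    finally show ?thesis .
  qed
  moreover have "compact (convex hull (e ` {..m}))"
    by (simp add: finite_imp_compact_convex_hull)
  ultimately show ?thesis by (intro that[of "convex hull (e ` {..m})"]) auto
qed

lemma tendsto_component:
  assumes "(f \<longlongrightarrow> l) F"
  shows "((\<lambda>k. f k i) \<longlongrightarrow> l i) F"
  by (rule continuous_on_tendsto_compose[OF continuous_on_product_coordinates assms]) auto

text \<open>
  The Bolzano-Weierstrass property of the space of multiplier profiles: each component stays in a
  compact set, and a product of compact sets is compact.
\<close>

lemma bounded_nonneg_convergent_subsequence:
  fixes \<mu> :: "nat \<Rightarrow> 'i::countable \<Rightarrow> fvec"
  assumes \<mu>: "\<And>k i. \<mu> k i \<in> Rn (p i)" "\<And>k i j. j < p i \<Longrightarrow> 0 \<le> Poly_Mapping.lookup (\<mu> k i) j"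
    and bound: "\<And>i j. j < p i \<Longrightarrow> Bseq (\<lambda>k. Poly_Mapping.lookup (\<mu> k i) j)"
  obtains r L where "strict_mono r" "(\<mu> \<circ> r) \<longlonglongrightarrow> L"
proof -
  have "\<exists>K. compact K \<and> (\<forall>k. \<mu> k i \<in> K)" for i
  proof -
    have "\<exists>c. \<forall>k. \<bar>Poly_Mapping.lookup (\<mu> k i) j\<bar> \<le> c" if "j < p i" for j
      using bound[OF that] by (auto simp: Bseq_def)
    then obtain c where c: "\<And>j k. j < p i \<Longrightarrow> \<bar>Poly_Mapping.lookup (\<mu> k i) j\<bar> \<le> c j" by metis
    have c0: "0 \<le> c j" if "j < p i" for j using c[OF that, of 0] by linarith
    define C where "C = 1 + (\<Sum>j<p i. c j)"
    have C: "C > 0" using sum_nonneg[of "{..<p i}" c] c0 by (simp add: C_def)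
    have "(\<Sum>j<p i. Poly_Mapping.lookup (\<mu> k i) j) \<le> C" for k
      using sum_mono[of "{..<p i}" "Poly_Mapping.lookup (\<mu> k i)" c] c
      by (force simp: C_def abs_le_iff)
    then show ?thesis
      using bounded_nonneg_vectors_in_compact[OF C, of "p i"] \<mu> by (smt (verit) mem_Collect_eq subsetD)
  qed
  then obtain K where K: "\<And>i. compact (K i)" "\<And>k i. \<mu> k i \<in> K i" by metis
  have "compact (PiE UNIV K)"
    using K(1) compactin_PiE[of "\<lambda>i. euclidean" UNIV K]
    by (simp add: euclidean_product_topology)
  then have "seq_compact (PiE UNIV K)" by (rule compact_imp_seq_compact)
  moreover have "\<And>k. \<mu> k \<in> PiE UNIV K" using K(2) by auto
  ultimately show ?thesis using that by (metis seq_compactE)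
qed

lemma tendsto_objective_gradient:
  assumes smooth: "smooth_followers d p \<theta> g"
    and X: "(X \<longlongrightarrow> x) F" and Y: "(Y \<longlongrightarrow> y) F" "\<And>k. Y k \<in> profiles d" "y \<in> profiles d"
  shows "((\<lambda>k. gradient (d i) (\<lambda>v. \<theta> i (X k) ((Y k)(i := v))) (Y k i)) \<longlongrightarrow>
      gradient (d i) (\<lambda>v. \<theta> i x (y(i := v))) (y i)) F"
proof -
  have "continuous_on (UNIV \<times> profiles d) (\<lambda>(x, y). gradient (d i) (\<lambda>v. \<theta> i x (y(i := v))) (y i))"
    using smooth by (simp add: smooth_followers_def)
  from continuous_on_tendsto_compose[OF this tendsto_Pair[OF X Y(1)]] Y(2,3) show ?thesis by simp
qed

lemma tendsto_constraint_gradient: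
  assumes smooth: "smooth_followers d p \<theta> g" and j: "j < p i"
    and X: "(X \<longlongrightarrow> x) F" and V: "(V \<longlongrightarrow> v) F" "\<And>k. V k \<in> Rn (d i)" "v \<in> Rn (d i)"
  shows "((\<lambda>k. gradient (d i) (g i j (X k)) (V k)) \<longlongrightarrow> gradient (d i) (g i j x) v) F"
proof -
  have "continuous_on (UNIV \<times> Rn (d i)) (\<lambda>(x, v). gradient (d i) (g i j x) v)"
    using smooth j by (simp add: smooth_followers_def)
  from continuous_on_tendsto_compose[OF this tendsto_Pair[OF X V(1)]] V(2,3) show ?thesis by simp
qed

text \<open>
  Convexity upgrades continuity in \<open>x\<close> to joint continuity. The gradient inequality
  at \<open>v\<close> bounds \<open>g i j (X k) (V k)\<close> from below, the one at \<open>V k\<close> bounds it from above, and both bounds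
  tend to \<open>g i j x v\<close> because the gradients converge.
\<close>

lemma tendsto_constraint:
  assumes smooth: "smooth_followers d p \<theta> g" and convex: "convex_followers d p \<theta> g"
    and g_continuous: "continuous_on UNIV (\<lambda>x. g i j x v)" and j: "j < p i"
    and X: "(X \<longlongrightarrow> x) F" and V: "(V \<longlongrightarrow> v) F" "\<And>k. V k \<in> Rn (d i)" "v \<in> Rn (d i)"
  shows "((\<lambda>k. g i j (X k) (V k)) \<longlongrightarrow> g i j x v) F"
proof -
  let ?D = "\<lambda>x. gradient (d i) (g i j x)"
  have cvx: "convex_on (Rn (d i)) (g i j x)" for x
    using convex j by (simp add: convex_followers_def)
  have grad: "w \<in> Rn (d i) \<Longrightarrow> has_gradient (d i) (g i j x) w (?D x w)" for x w
    by (rule has_gradient_constraint[OF smooth j])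
  have fixed: "((\<lambda>k. g i j (X k) v) \<longlongrightarrow> g i j x v) F"
    by (rule continuous_on_tendsto_compose[OF g_continuous X]) auto
  have lower: "((\<lambda>k. g i j (X k) v + dot (d i) (?D (X k) v) (V k - v)) \<longlongrightarrow>
      g i j x v + dot (d i) (?D x v) (v - v)) F"
    by (intro tendsto_intros fixed tendsto_constraint_gradient[OF smooth j] X V)
  have upper: "((\<lambda>k. g i j (X k) v - dot (d i) (?D (X k) (V k)) (v - V k)) \<longlongrightarrow>
      g i j x v - dot (d i) (?D x v) (v - v)) F"
    by (intro tendsto_intros fixed tendsto_constraint_gradient[OF smooth j] X V)
  show ?thesis
  proof (rule tendsto_sandwich)
    show "((\<lambda>k. g i j (X k) v + dot (d i) (?D (X k) v) (V k - v)) \<longlongrightarrow> g i j x v) F"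
      using lower by (simp add: dot_zero_right)
    show "((\<lambda>k. g i j (X k) v - dot (d i) (?D (X k) (V k)) (v - V k)) \<longlongrightarrow> g i j x v) F"
      using upper by (simp add: dot_zero_right)
  qed (use gradient_inequality[OF cvx grad[OF V(3)] V(3) V(2)]
      gradient_inequality[OF cvx grad[OF V(2)] V(2,3)] in \<open>simp_all add: le_diff_eq\<close>)
qed

lemma Rn_limit:
  assumes "\<And>k. u k \<in> Rn m" "u \<longlonglongrightarrow> v"
  shows "v \<in> Rn m"
proof -
  have "Poly_Mapping.lookup v j = 0" if "j \<ge> m" for j
    using tendsto_lookup[OF assms(2), of j] lookup_0_Rn[OF assms(1) that]
    by (simp add: LIMSEQ_const_iff)
  then show ?thesis unfolding Rn_def by (force simp: in_keys_iff not_le[symmetric])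
qed

text \<open>
  Every condition that defines a multiplier is a closed condition on quantities that converge along the
  sequence.
\<close>

lemma multipliers_closed:
  assumes smooth: "smooth_followers d p \<theta> g" and convex: "convex_followers d p \<theta> g"
    and g_continuous: "\<And>i j v. j < p i \<Longrightarrow> v \<in> Rn (d i) \<Longrightarrow> continuous_on UNIV (\<lambda>x. g i j x v)"
    and X: "X \<longlonglongrightarrow> x" and Y: "Y \<longlonglongrightarrow> y" "\<And>k. Y k \<in> profiles d" "y \<in> profiles d"
    and \<mu>: "\<And>k. \<mu> k \<in> multipliers d p \<theta> g (X k) (Y k)" "\<mu> \<longlonglongrightarrow> L"
  shows "L \<in> multipliers d p \<theta> g x y"
proof -
  have "L i \<in> follower_multipliers d p \<theta> g i x y" for i
  proof -
    have Yi: "\<And>k. Y k i \<in> Rn (d i)" "y i \<in> Rn (d i)" using Y by (auto simp: profiles_def)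
    have m: "\<mu> k i \<in> follower_multipliers d p \<theta> g i (X k) (Y k)" for k
      using \<mu>(1)[of k] by (simp add: multipliers_def)
    note Yl = tendsto_component[OF Y(1), of i] and \<mu>l = tendsto_component[OF \<mu>(2), of i]
    have gl: "(\<lambda>k. g i j (X k) (Y k i)) \<longlonglongrightarrow> g i j x (y i)" if "j < p i" for j
      by (rule tendsto_constraint[where p = p, OF smooth convex g_continuous])
        (use that Yi Yl X in auto)
    have "L i \<in> Rn (p i)"
      by (rule Rn_limit[OF _ \<mu>l]) (use m in \<open>simp add: follower_multipliers_def\<close>)
    moreover have "g i j x (y i) \<le> 0" "0 \<le> Poly_Mapping.lookup (L i) j" if "j < p i" for j
      using m that
      by (auto intro!: LIMSEQ_le_const2[OF gl] LIMSEQ_le_const[OF tendsto_lookup[OF \<mu>l]]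
          simp: follower_multipliers_def)
    moreover have "(\<lambda>k. \<Sum>j<p i. Poly_Mapping.lookup (\<mu> k i) j * g i j (X k) (Y k i)) \<longlonglongrightarrow>
        (\<Sum>j<p i. Poly_Mapping.lookup (L i) j * g i j x (y i))"
      by (intro tendsto_intros \<mu>l gl) simp
    then have "(\<Sum>j<p i. Poly_Mapping.lookup (L i) j * g i j x (y i)) = 0"
      using m by (simp add: follower_multipliers_def LIMSEQ_const_iff)
    moreover have "(\<lambda>k. gradient (d i) (\<lambda>v. \<theta> i (X k) ((Y k)(i := v))) (Y k i)
          + (\<Sum>j<p i. Poly_Mapping.lookup (\<mu> k i) j *\<^sub>R gradient (d i) (g i j (X k)) (Y k i))) \<longlonglongrightarrow>
        gradient (d i) (\<lambda>v. \<theta> i x (y(i := v))) (y i)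
          + (\<Sum>j<p i. Poly_Mapping.lookup (L i) j *\<^sub>R gradient (d i) (g i j x) (y i))"
      by (intro tendsto_add tendsto_sum tendsto_scaleR tendsto_lookup \<mu>l tendsto_objective_gradient[OF smooth]
          tendsto_constraint_gradient[OF smooth] X Y Yl Yi) simp
    then have "gradient (d i) (\<lambda>v. \<theta> i x (y(i := v))) (y i)
          + (\<Sum>j<p i. Poly_Mapping.lookup (L i) j *\<^sub>R gradient (d i) (g i j x) (y i)) = 0"
      using m by (simp add: follower_multipliers_def LIMSEQ_const_iff)
    ultimately show ?thesis by (simp add: follower_multipliers_def)
  qed
  then show ?thesis by (simp add: multipliers_def)
qed

text \<open>
  If \<open>s\<close> is a Slater point for all \<open>X k\<close>, the lower bound on the combination of the constraints, taken at
  \<open>s\<close>, has only terms of one sign. So each multiplier satisfies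
  \<open>\<mu>\<^sub>j * (- g\<^sub>j(s)) \<le> \<langle>\<nabla>\<theta>, s - y\<rangle>\<close>. The right-hand side and the factor \<open>- g\<^sub>j(s)\<close> converge, and the
  limit of this factor is positive since \<open>s\<close> is a Slater point for the limit \<open>x\<close> too.
\<close>

lemma multipliers_bounded:
  assumes smooth: "smooth_followers d p \<theta> g" and convex: "convex_followers d p \<theta> g"
    and g_continuous: "\<And>i j v. j < p i \<Longrightarrow> v \<in> Rn (d i) \<Longrightarrow> continuous_on UNIV (\<lambda>x. g i j x v)"
    and X: "X \<longlonglongrightarrow> x" and Y: "Y \<longlonglongrightarrow> y" "\<And>k. Y k \<in> profiles d" "y \<in> profiles d"
    and \<mu>: "\<And>k. \<mu> k \<in> multipliers d p \<theta> g (X k) (Y k)"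
    and s: "s \<in> Rn (d i)" "\<And>k j. j < p i \<Longrightarrow> g i j (X k) s < 0" "\<And>j. j < p i \<Longrightarrow> g i j x s < 0"
    and j: "j < p i"
  shows "Bseq (\<lambda>k. Poly_Mapping.lookup (\<mu> k i) j)"
proof -
  define a where "a k = gradient (d i) (\<lambda>v. \<theta> i (X k) ((Y k)(i := v))) (Y k i)" for k
  define B where "B k = dot (d i) (a k) (s - Y k i) / - g i j (X k) s" for k
  have Yi: "Y k i \<in> Rn (d i)" for k using Y by (auto simp: profiles_def)
  have "0 \<le> Poly_Mapping.lookup (\<mu> k i) j \<and> Poly_Mapping.lookup (\<mu> k i) j \<le> B k" for k
  proof -
    let ?l = "Poly_Mapping.lookup (\<mu> k i)"
    have m: "\<mu> k i \<in> follower_multipliers d p \<theta> g i (X k) (Y k)"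
      using \<mu>[of k] by (simp add: multipliers_def)
    have cg: "j < p i \<Longrightarrow> convex_on (Rn (d i)) (g i j (X k))" for j
      using convex by (simp add: convex_followers_def)
    have "0 \<le> ?l j * - g i j (X k) s" if "j < p i" for j
      using m s(2)[OF that, of k] that
      by (intro mult_nonneg_nonneg) (simp_all add: follower_multipliers_def)
    then have "?l j * - g i j (X k) s \<le> (\<Sum>j<p i. ?l j * - g i j (X k) s)"
      using j by (intro member_le_sum[of j _ "\<lambda>j. ?l j * - g i j (X k) s"]) auto
    also have "\<dots> = - (\<Sum>j<p i. ?l j * g i j (X k) s)" by (simp add: sum_negf)
    also have "\<dots> \<le> dot (d i) (a k) (s - Y k i)"
      using m constraint_combination_lower_bound[where g = "\<lambda>j. g i j (X k)" and p = "p i" and a = "a k" and l = ?l,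
          OF Yi s(1) has_gradient_constraint[where p = p, OF smooth _ Yi] cg]
      by (force simp: follower_multipliers_def a_def)
    finally have "?l j \<le> B k"
      using s(2)[OF j] by (simp add: B_def pos_le_divide_eq del: mult_minus_right divide_minus_right)
    then show ?thesis using m j by (simp add: follower_multipliers_def)
  qed
  moreover have "B \<longlonglongrightarrow> dot (d i) (gradient (d i) (\<lambda>v. \<theta> i x (y(i := v))) (y i)) (s - y i) / - g i j x s"
    unfolding B_def a_def using s(3)[OF j]
    by (intro tendsto_intros tendsto_objective_gradient[OF smooth] X Y tendsto_component[OF Y(1)]
        continuous_on_tendsto_compose[OF g_continuous[OF j s(1)] X]) auto
  then have "Bseq B" by (intro convergent_imp_Bseq convergentI)
  ultimately show ?thesis
    by (elim Bseq_eventually_mono[rotated]) (auto intro!: always_eventually order_trans[OF _ abs_ge_self])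
qed

lemma multipliers_subsequence:
  fixes \<mu> :: "nat \<Rightarrow> 'i::countable \<Rightarrow> fvec"
  assumes smooth: "smooth_followers d p \<theta> g" and convex: "convex_followers d p \<theta> g"
    and g_continuous: "\<And>i j v. j < p i \<Longrightarrow> v \<in> Rn (d i) \<Longrightarrow> continuous_on UNIV (\<lambda>x. g i j x v)"
    and X: "X \<longlonglongrightarrow> x" and Y: "Y \<longlonglongrightarrow> y" "\<And>k. Y k \<in> profiles d" "y \<in> profiles d"
    and \<mu>: "\<And>k. \<mu> k \<in> multipliers d p \<theta> g (X k) (Y k)"
    and s: "\<And>i. s i \<in> Rn (d i)" "\<And>k i j. j < p i \<Longrightarrow> g i j (X k) (s i) < 0"
      "\<And>i j. j < p i \<Longrightarrow> g i j x (s i) < 0"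
  obtains r L where "strict_mono r" "(\<mu> \<circ> r) \<longlonglongrightarrow> L" "L \<in> multipliers d p \<theta> g x y"
proof -
  obtain r L where r: "strict_mono r" "(\<mu> \<circ> r) \<longlonglongrightarrow> L"
  proof (rule bounded_nonneg_convergent_subsequence[of \<mu> p])
    show "Bseq (\<lambda>k. Poly_Mapping.lookup (\<mu> k i) j)" if "j < p i" for i j
      using multipliers_bounded[OF smooth convex g_continuous X Y \<mu> s(1,2,3) that] .
  qed (use \<mu> in \<open>auto simp: multipliers_def follower_multipliers_def\<close>)
  have "(\<lambda>k. X (r k)) \<longlonglongrightarrow> x" "(\<lambda>k. Y (r k)) \<longlonglongrightarrow> y"
    using LIMSEQ_subseq_LIMSEQ[OF X r(1)] LIMSEQ_subseq_LIMSEQ[OF Y(1) r(1)] by (simp_all add: o_def)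
  then have "L \<in> multipliers d p \<theta> g x y"
    using multipliers_closed[OF smooth convex g_continuous, of "\<lambda>k. X (r k)" x "\<lambda>k. Y (r k)" y "\<mu> \<circ> r" L] Y \<mu> r(2)
    by simp
  with r show ?thesis by (rule that)
qed

text \<open>
  The Slater points of \<open>x\<close> serve for all nearby parameters. There are finitely many strict
  inequalities, each of them open in the parameter.
\<close>

lemma slater_stable:
  fixes x :: "'x::t2_space" and p :: "'i::finite \<Rightarrow> nat"
  assumes g_continuous: "\<And>i j v. j < p i \<Longrightarrow> v \<in> Rn (d i) \<Longrightarrow> continuous_on UNIV (\<lambda>x. g i j x v)"
    and s: "\<And>i. s i \<in> Rn (d i)" "\<And>i j. j < p i \<Longrightarrow> g i j x (s i) < 0"
  obtains V where "open V" "x \<in> V" "\<forall>x\<in>V. \<forall>i. \<forall>j<p i. g i j x (s i) < (0::real)"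
proof
  let ?V = "\<Inter>i. \<Inter>j\<in>{..<p i}. {x. g i j x (s i) < 0}"
  show "open ?V"
    using g_continuous s(1) by (intro open_INT ballI finite open_Collect_less finite_lessThan) auto
qed (use s in auto)

section \<open>Local solutions of the game\<close>

theorem theorem4:
  fixes X :: "(real ^ 'm) set"
    and \<theta>0 :: "real ^ 'm \<Rightarrow> ('i::finite \<Rightarrow> fvec) \<Rightarrow> real"
    and d p :: "'i \<Rightarrow> nat"
    and \<theta> :: "'i \<Rightarrow> real ^ 'm \<Rightarrow> ('i \<Rightarrow> fvec) \<Rightarrow> real"
    and g :: "'i \<Rightarrow> nat \<Rightarrow> real ^ 'm \<Rightarrow> fvec \<Rightarrow> real"
    and xbar :: "real ^ 'm"
    and ybar :: "'i \<Rightarrow> fvec"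
  assumes smooth: "smooth_followers d p \<theta> g"
    and g_continuous: "\<And>i j v. j < p i \<Longrightarrow> v \<in> Rn (d i) \<Longrightarrow> continuous_on UNIV (\<lambda>x. g i j x v)"
    and convex: "convex_followers d p \<theta> g"
    and slater: "\<And>i. slater d p g i xbar"
    and ybar: "ybar \<in> profiles d"
    and nonempty: "multipliers d p \<theta> g xbar ybar \<noteq> {}"
    and local: "\<And>\<mu>. \<mu> \<in> multipliers d p \<theta> g xbar ybar \<Longrightarrow>
                  MPCC_local_solution X \<theta>0 d p \<theta> g xbar ybar \<mu>"
  shows "SLMFG_local_solution X \<theta>0 d p \<theta> g xbar ybar"
proof (rule ccontr)
  assume not_local: "\<not> SLMFG_local_solution X \<theta>0 d p \<theta> g xbar ybar"
  obtain \<mu>0 where \<mu>0: "\<mu>0 \<in> multipliers d p \<theta> g xbar ybar" using nonempty by blast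
  have "xbar \<in> X"
    using local[OF \<mu>0] by (simp add: MPCC_local_solution_def local_solution_def MPCC_feasible_def)
  then have feasible: "(xbar, ybar) \<in> SLMFG_feasible X d p \<theta> g"
    using multipliers_imp_NEP[OF smooth convex ybar \<mu>0] by (simp add: SLMFG_feasible_def)
  have "\<exists>s. \<forall>i. s i \<in> Rn (d i) \<and> (\<forall>j<p i. g i j xbar (s i) < 0)"
    using slater unfolding slater_def by (intro choice) blast
  then obtain s where s: "\<And>i. s i \<in> Rn (d i)" "\<And>i j. j < p i \<Longrightarrow> g i j xbar (s i) < 0"
    by blast
  obtain V where V: "open V" "xbar \<in> V" "\<forall>x\<in>V. \<forall>i. \<forall>j<p i. g i j x (s i) < 0"
    by (rule slater_stable[where p = p and d = d and g = g and s = s, OF g_continuous s])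
  \<comment> \<open>The points that beat \<open>(xbar, ybar)\<close>, restricted to parameters for which \<open>s\<close> remains a Slater point.\<close>
  define S where "S = {(x, y) \<in> SLMFG_feasible X d p \<theta> g. x \<in> V \<and> \<theta>0 x y < \<theta>0 xbar ybar}"
  have "(xbar, ybar) \<in> closure S"
    unfolding closure_iff_nhds_not_empty
  proof (intro allI impI notI)
    fix A U assume U: "U \<subseteq> A" "open U" "(xbar, ybar) \<in> U" and empty: "S \<inter> A = {}"
    have "open (U \<inter> (V \<times> UNIV))" "(xbar, ybar) \<in> U \<inter> (V \<times> UNIV)"
      using U V by (auto intro: open_Times)
    moreover have "\<theta>0 xbar ybar \<le> \<theta>0 x y"
      if "(x, y) \<in> SLMFG_feasible X d p \<theta> g" "(x, y) \<in> U \<inter> (V \<times> UNIV)" for x y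
      using that empty U(1) by (force simp: S_def not_less[symmetric])
    ultimately have "SLMFG_local_solution X \<theta>0 d p \<theta> g xbar ybar"
      unfolding SLMFG_local_solution_def local_solution_def using feasible by fast
    with not_local show False by contradiction
  qed
  then obtain Z where Z: "\<And>k. Z k \<in> S" "Z \<longlonglongrightarrow> (xbar, ybar)"
    unfolding closure_sequential by blast
  define x y where "x k = fst (Z k)" and "y k = snd (Z k)" for k
  have lim: "x \<longlonglongrightarrow> xbar" "y \<longlonglongrightarrow> ybar"
    using tendsto_fst[OF Z(2)] tendsto_snd[OF Z(2)] by (simp_all add: x_def[abs_def] y_def[abs_def])
  have S: "x k \<in> X" "y k \<in> NEP d p \<theta> g (x k)" "x k \<in> V" "\<theta>0 (x k) (y k) < \<theta>0 xbar ybar" for k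
    using Z(1)[of k] by (auto simp: S_def SLMFG_feasible_def x_def y_def)
  have yp: "y k \<in> profiles d" for k using S(2)[of k] by (simp add: NEP_def)
  have "\<exists>\<mu>. \<mu> \<in> multipliers d p \<theta> g (x k) (y k)" for k
  proof -
    have "slater d p g i (x k)" for i
      using V(3)[rule_format, OF S(3)] s(1)[of i] by (auto simp: slater_def)
    then show ?thesis using NEP_imp_multipliers[OF smooth convex S(2)[of k]] by blast
  qed
  then obtain \<mu> where \<mu>: "\<And>k. \<mu> k \<in> multipliers d p \<theta> g (x k) (y k)" by metis
  obtain r L where r: "strict_mono r" "(\<mu> \<circ> r) \<longlonglongrightarrow> L" "L \<in> multipliers d p \<theta> g xbar ybar"
    by (rule multipliers_subsequence[OF smooth convex g_continuous lim yp ybar \<mu> s(1) V(3)[rule_format, OF S(3)] s(2)])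
  obtain U where U: "open U" "(xbar, ybar, L) \<in> U"
    "\<forall>(x, y, \<mu>) \<in> MPCC_feasible X d p \<theta> g \<inter> U. \<theta>0 xbar ybar \<le> \<theta>0 x y"
    using local[OF r(3)] unfolding MPCC_local_solution_def local_solution_def
    by (auto simp: case_prod_beta)
  have "(\<lambda>k. (x (r k), y (r k), \<mu> (r k))) \<longlonglongrightarrow> (xbar, ybar, L)"
    using LIMSEQ_subseq_LIMSEQ[OF lim(1) r(1)] LIMSEQ_subseq_LIMSEQ[OF lim(2) r(1)] r(2)
    by (intro tendsto_Pair) (simp_all add: o_def)
  from topological_tendstoD[OF this U(1,2)]
  obtain k where "(x (r k), y (r k), \<mu> (r k)) \<in> U"
    using eventually_happens'[OF sequentially_bot] by blast
  moreover have "(x (r k), y (r k), \<mu> (r k)) \<in> MPCC_feasible X d p \<theta> g"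
    using S(1) yp \<mu> by (simp add: MPCC_feasible_def)
  ultimately have "\<theta>0 xbar ybar \<le> \<theta>0 (x (r k)) (y (r k))"
    using U(3) by fast
  then show False using S(4)[of "r k"] by simp
qed

end
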